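(* Let $A, \tilde{A} \in \mathbf{L}(\mathcal{B}_w,\mathcal{B}_s)$ and let $\lambda \in \sigma_{\rm point}(A, \mathcal{B}_s)$. Then for all $\delta>0$ with $$\delta \geq \gamma_A(\lambda)\, \| A - \tilde{A}\|_{s \to w}$$ we have $\lambda \in \sigma_\delta(\tilde{A}, \mathcal{B}_w)$.
   Context: Let $(\mathcal{B}_w, |\cdot|_w)$ be a complex Banach space and $\mathcal{B}_s \subset \mathcal{B}_w$ a subspace equipped with a norm $|\cdot|_s$ for which $(\mathcal{B}_s,|\cdot|_s)$ is also a Banach space. Assume throughout that $\mathcal{B}_s$ is dense in $(\mathcal{B}_w,|\cdot|_w)$ and that $|f|_w \le |f|_s$ for all $f\in\mathcal{B}_s$. $\mathbf{L}(\mathcal{B}_w,\mathcal{B}_s)$ is the set of bounded linear operators $A:\mathcal{B}_w\to\mathcal{B}_w$ such that $A(\mathcal{B}_s)\subset\mathcal{B}_s$ and $A|_{\mathcal{B}_s}:\mathcal{B}_s\to\mathcal{B}_s$ is bounded with respect to $|\cdot|_s$. For such an operator the mixed norm is $\|A\|_{s\to w}=\sup_{v\in\mathcal{B}_s\setminus\{0\}} |Av|_w/|v|_s$. For a bounded operator $A$ on a Banach space $\mathcal{B}$ with norm $|\cdot|$ (also used for the induced operator norm): $\sigma(A,\mathcal{B})$ is the spectrum; $\sigma_{\rm point}(A,\mathcal{B})$ is the isolated point spectrum, i.e. the set of discrete eigenvalues (isolated points of the spectrum that are eigenvalues of finite algebraic multiplicity); and for $\delta>0$ the $\delta$-pseudospectrum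 is $$\sigma_\delta(A,\mathcal{B})=\sigma(A,\mathcal{B})\cup\{z\in\mathbb{C}: z-A \text{ is boundedly invertible and } |(z-A)^{-1}|\ge\delta^{-1}\}.$$ For $\lambda\in\sigma_{\rm point}(A,\mathcal{B}_s)$, $$\gamma_A(\lambda)=\inf\left\{\frac{|f|_s}{|f|_w}: f\in\mathcal{B}_s\setminus\{0\},\ Af=\lambda f\right\}.$$ *)

theory Defs
  imports "HOL-Analysis.Analysis"
begin

class complex_banach = banach +
  fixes scaleC :: "complex \<Rightarrow> 'a \<Rightarrow> 'a" (infixr "*\<^sub>C" 75)
  assumes scaleC_add_right: "a *\<^sub>C (x + y) = a *\<^sub>C x + a *\<^sub>C y"
    and scaleC_add_left: "(a + b) *\<^sub>C x = a *\<^sub>C x + b *\<^sub>C x"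
    and scaleC_scaleC: "a *\<^sub>C (b *\<^sub>C x) = (a * b) *\<^sub>C x"
    and scaleC_one: "1 *\<^sub>C x = x"
    and scaleC_of_real: "complex_of_real r *\<^sub>C x = r *\<^sub>R x"
    and norm_scaleC: "norm (a *\<^sub>C x) = cmod a * norm x"

global_interpretation complex_vector:
  vector_space "scaleC :: complex \<Rightarrow> 'a \<Rightarrow> 'a::complex_banach"
  by unfold_locales
    (simp_all add: scaleC_add_right scaleC_add_left scaleC_scaleC scaleC_one)

text \<open>
  The Banach space \<open>B_w\<close> is a whole type, normed by \<^const>\<open>norm\<close>. The space \<open>B_s\<close> is a
  set \<open>S\<close> in this type with its own norm \<open>ns\<close>, whose values outside \<open>S\<close> are irrelevant.
\<close>

locale strong_banach_subspace =
  fixes S :: "'w::complex_banach set" and ns :: "'w \<Rightarrow> real"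
  assumes subspace: "complex_vector.subspace S"
    and ns_zero_iff: "x \<in> S \<Longrightarrow> ns x = 0 \<longleftrightarrow> x = 0"
    and ns_triangle: "\<lbrakk>x \<in> S; y \<in> S\<rbrakk> \<Longrightarrow> ns (x + y) \<le> ns x + ns y"
    and ns_scaleC: "x \<in> S \<Longrightarrow> ns (c *\<^sub>C x) = cmod c * ns x"
    and ns_complete: "\<lbrakk>\<And>i. X i \<in> S; \<And>e. e > 0 \<Longrightarrow> \<exists>N. \<forall>i\<ge>N. \<forall>j\<ge>N. ns (X i - X j) < e\<rbrakk>
      \<Longrightarrow> \<exists>x\<in>S. (\<lambda>i. ns (X i - x)) \<longlonglongrightarrow> 0"
    and dense: "closure S = UNIV"
    and norm_le_ns: "x \<in> S \<Longrightarrow> norm x \<le> ns x"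

text \<open>
  The operator notions below are relative to a subspace \<open>V\<close> with norm \<open>n\<close>, so that they apply
  both to \<open>B_w\<close>, as \<open>UNIV\<close> with \<^const>\<open>norm\<close>, and to \<open>B_s\<close>, as \<open>S\<close> with \<open>ns\<close>. They
  depend only on the restrictions of the operator and of \<open>n\<close> to \<open>V\<close>.
\<close>

definition bounded_operator_on ::
    "'a::complex_banach set \<Rightarrow> ('a \<Rightarrow> real) \<Rightarrow> ('a \<Rightarrow> 'a) \<Rightarrow> bool" where
  "bounded_operator_on V n T \<longleftrightarrow>
     T ` V \<subseteq> V \<and>
     (\<forall>x\<in>V. \<forall>y\<in>V. T (x + y) = T x + T y) \<and>
     (\<forall>c. \<forall>x\<in>V. T (c *\<^sub>C x) = c *\<^sub>C T x) \<and>
     (\<exists>K. \<forall>x\<in>V. n (T x) \<le> K * n x)"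

text \<open>As in \<^const>\<open>onorm\<close>, the zero vector contributes \<open>0 / 0 = 0\<close> to the supremum.\<close>

definition operator_norm_on ::
    "'a::complex_banach set \<Rightarrow> ('a \<Rightarrow> real) \<Rightarrow> ('a \<Rightarrow> 'a) \<Rightarrow> real" where
  "operator_norm_on V n T = (SUP x\<in>V. n (T x) / n x)"

lemma operator_norm_on_UNIV: "operator_norm_on UNIV norm T = onorm T"
  by (simp add: operator_norm_on_def onorm_def)

definition boundedly_invertible_on ::
    "'a::complex_banach set \<Rightarrow> ('a \<Rightarrow> real) \<Rightarrow> ('a \<Rightarrow> 'a) \<Rightarrow> bool" where
  "boundedly_invertible_on V n T \<longleftrightarrow>
     bij_betw T V V \<and> bounded_operator_on V n (inv_into V T)"

definition spectrum_on ::
    "'a::complex_banach set \<Rightarrow> ('a \<Rightarrow> real) \<Rightarrow> ('a \<Rightarrow> 'a) \<Rightarrow> complex set" where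
  "spectrum_on V n A = {z. \<not> boundedly_invertible_on V n (\<lambda>x. z *\<^sub>C x - A x)}"

definition pseudospectrum_on ::
    "real \<Rightarrow> 'a::complex_banach set \<Rightarrow> ('a \<Rightarrow> real) \<Rightarrow> ('a \<Rightarrow> 'a) \<Rightarrow> complex set" where
  "pseudospectrum_on \<delta> V n A = spectrum_on V n A \<union>
     {z. boundedly_invertible_on V n (\<lambda>x. z *\<^sub>C x - A x) \<and>
         operator_norm_on V n (inv_into V (\<lambda>x. z *\<^sub>C x - A x)) \<ge> inverse \<delta>}"

definition generalized_eigenspace_on ::
    "'a::complex_banach set \<Rightarrow> ('a \<Rightarrow> 'a) \<Rightarrow> complex \<Rightarrow> 'a set" where
  "generalized_eigenspace_on V A z = {x\<in>V. \<exists>k. ((\<lambda>y. z *\<^sub>C y - A y) ^^ k) x = 0}"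

text \<open>
  Algebraic multiplicity is the dimension of the generalized eigenspace. It is at most the rank of
  the Riesz projection of an isolated spectral point, so every eigenvalue that is discrete in the
  sense of a Riesz projection of finite rank is included.
\<close>

definition point_spectrum_on ::
    "'a::complex_banach set \<Rightarrow> ('a \<Rightarrow> real) \<Rightarrow> ('a \<Rightarrow> 'a) \<Rightarrow> complex set" where
  "point_spectrum_on V n A = {z.
     z isolated_in spectrum_on V n A \<and>
     (\<exists>x\<in>V - {0}. A x = z *\<^sub>C x) \<and>
     (\<exists>B. finite B \<and> generalized_eigenspace_on V A z \<subseteq> complex_vector.span B)}"

definition weak_strong_operators ::
    "'w::complex_banach set \<Rightarrow> ('w \<Rightarrow> real) \<Rightarrow> ('w \<Rightarrow> 'w) set" where
  "weak_strong_operators S ns =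
     {A. bounded_operator_on UNIV norm A \<and> bounded_operator_on S ns A}"

definition mixed_norm ::
    "'w::complex_banach set \<Rightarrow> ('w \<Rightarrow> real) \<Rightarrow> ('w \<Rightarrow> 'w) \<Rightarrow> real" where
  "mixed_norm S ns A = (SUP v\<in>S - {0}. norm (A v) / ns v)"

definition eigen_gamma ::
    "'w::complex_banach set \<Rightarrow> ('w \<Rightarrow> real) \<Rightarrow> ('w \<Rightarrow> 'w) \<Rightarrow> complex \<Rightarrow> real" where
  "eigen_gamma S ns A z = (INF f\<in>{f\<in>S - {0}. A f = z *\<^sub>C f}. ns f / norm f)"

end

theory Submission
  imports Defs
begin

text \<open>
  An eigenvector \<open>f\<close> of \<open>A\<close> for \<open>\<mu>\<close> is an approximate eigenvector of \<open>A'\<close>: its residual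
  \<open>\<mu> f - A' f\<close> equals \<open>(A - A') f\<close>, whose weak norm is at most \<open>m * ns f\<close>, where \<open>m\<close> is the
  mixed norm of \<open>A - A'\<close> (\<open>norm_le_mixed_norm\<close>). If \<open>\<mu>\<close> is outside the spectrum of \<open>A'\<close> on the
  weak space, the resolvent, of norm \<open>M\<close>, recovers \<open>f\<close> from this residual
  (\<open>norm_le_operator_norm_inverse_times_image\<close>), so that \<open>1 \<le> M * m * (ns f / norm f)\<close>.
  Minimising the last factor over all eigenvectors replaces it by \<open>eigen_gamma\<close>
  (\<open>one_le_mult_eigen_gamma\<close>). Its product with \<open>m\<close> is at most \<open>\<delta>\<close>, hence \<open>M \<ge> inverse \<delta>\<close>.
\<close>

lemma bounded_linear_if_bounded_operator_on_UNIV: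
  assumes "bounded_operator_on UNIV norm T"
  shows "bounded_linear T"
proof -
  from assms obtain K where K: "\<And>x. norm (T x) \<le> K * norm x"
    unfolding bounded_operator_on_def by blast
  show ?thesis
  proof (rule bounded_linear_intro)
    show "T (x + y) = T x + T y" for x y
      using assms by (simp add: bounded_operator_on_def)
    have "T (complex_of_real r *\<^sub>C x) = complex_of_real r *\<^sub>C T x" for r x
      using assms by (simp add: bounded_operator_on_def)
    then show "T (r *\<^sub>R x) = r *\<^sub>R T x" for r x
      by (simp add: scaleC_of_real)
    show "norm (T x) \<le> norm x * K" for x
      using K by (simp add: mult.commute)
  qed
qed

lemma norm_le_operator_norm_inverse_times_image:
  assumes "boundedly_invertible_on UNIV norm T"
  shows "norm x \<le> operator_norm_on UNIV norm (inv T) * norm (T x)"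
proof -
  have "bounded_linear (inv T)" and "inj T"
    using assms bounded_linear_if_bounded_operator_on_UNIV
    by (auto simp: boundedly_invertible_on_def bij_betw_def)
  then show ?thesis
    using onorm[of "inv T" "T x"] by (simp add: operator_norm_on_UNIV)
qed

context strong_banach_subspace
begin

lemma ns_pos:
  assumes "v \<in> S - {0}"
  shows "0 < ns v"
  using assms norm_le_ns[of v] by (smt (verit) Diff_iff singletonI zero_less_norm_iff)

text \<open>
  A bound in the weak norm makes the mixed norm finite, because the strong norm
  dominates the weak one. Finiteness matters: a real supremum bounds the quotients only if they
  are bounded above.
\<close>

lemma norm_le_mixed_norm:
  assumes "bounded_linear T" and v: "v \<in> S - {0}"
  shows "norm (T v) \<le> mixed_norm S ns T * ns v"
proof -
  obtain K where K: "0 \<le> K" "\<And>x. norm (T x) \<le> norm x * K"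
    using bounded_linear.nonneg_bounded[OF assms(1)] by blast
  have "norm (T w) / ns w \<le> K" if "w \<in> S - {0}" for w
  proof -
    have "norm (T w) \<le> norm w * K" by (rule K)
    also have "\<dots> \<le> ns w * K"
      using norm_le_ns that K(1) by (intro mult_right_mono) auto
    finally show ?thesis
      using ns_pos[OF that] by (simp add: divide_simps mult.commute)
  qed
  then have "bdd_above ((\<lambda>w. norm (T w) / ns w) ` (S - {0}))"
    by (rule bdd_aboveI2)
  then have "norm (T v) / ns v \<le> mixed_norm S ns T"
    unfolding mixed_norm_def using v by (intro cSUP_upper)
  then show ?thesis
    using ns_pos[OF v] by (simp add: divide_simps)
qed

end

text \<open>
  An eigenvector has positive norm, which forces \<open>c > 0\<close>. Then \<open>1 / c\<close> is a lower bound of all the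
  quotients \<open>ns f / norm f\<close> and hence of their infimum, whether or not an eigenvector attains it.
\<close>

lemma one_le_mult_eigen_gamma:
  assumes ex: "\<exists>f\<in>S - {0}. A f = z *\<^sub>C f"
    and "0 \<le> c"
    and le: "\<And>f. f \<in> S - {0} \<Longrightarrow> A f = z *\<^sub>C f \<Longrightarrow> norm f \<le> c * ns f"
  shows "1 \<le> c * eigen_gamma S ns A z"
proof -
  have "c \<noteq> 0"
    using ex le by force
  then have "0 < c"
    using \<open>0 \<le> c\<close> by simp
  have "1 / c \<le> eigen_gamma S ns A z"
    unfolding eigen_gamma_def
  proof (rule cINF_greatest)
    show "{f \<in> S - {0}. A f = z *\<^sub>C f} \<noteq> {}"
      using ex by blast
    show "1 / c \<le> ns f / norm f" if "f \<in> {f \<in> S - {0}. A f = z *\<^sub>C f}" for f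
      using le[of f] that \<open>0 < c\<close> by (simp add: field_simps)
  qed
  then show ?thesis
    using \<open>0 < c\<close> by (simp add: field_simps)
qed

theorem proposition2p2:
  fixes S :: "'w::complex_banach set" and ns :: "'w \<Rightarrow> real"
    and A A' :: "'w \<Rightarrow> 'w" and \<mu> :: complex and \<delta> :: real
  assumes "strong_banach_subspace S ns"
    and "A \<in> weak_strong_operators S ns"
    and "A' \<in> weak_strong_operators S ns"
    and "\<mu> \<in> point_spectrum_on S ns A"
    and "\<delta> > 0"
    and "\<delta> \<ge> eigen_gamma S ns A \<mu> * mixed_norm S ns (\<lambda>x. A x - A' x)"
  shows "\<mu> \<in> pseudospectrum_on \<delta> UNIV norm A'"
proof (cases "\<mu> \<in> spectrum_on UNIV norm A'")
  case True
  then show ?thesis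
    by (simp add: pseudospectrum_on_def)
next
  case False
  interpret strong_banach_subspace S ns
    by (rule assms(1))
  define R where "R = inv (\<lambda>x. \<mu> *\<^sub>C x - A' x)"
  define M where "M = operator_norm_on UNIV norm R"
  define m where "m = mixed_norm S ns (\<lambda>x. A x - A' x)"
  have inv: "boundedly_invertible_on UNIV norm (\<lambda>x. \<mu> *\<^sub>C x - A' x)"
    using False by (simp add: spectrum_on_def)
  then have "bounded_linear R"
    unfolding R_def boundedly_invertible_on_def
    by (blast intro: bounded_linear_if_bounded_operator_on_UNIV)
  then have "0 \<le> M"
    unfolding M_def operator_norm_on_UNIV by (rule onorm_pos_le)
  have diff: "bounded_linear (\<lambda>x. A x - A' x)"
    using assms(2,3)
    by (auto simp: weak_strong_operators_def
        intro: bounded_linear_sub bounded_linear_if_bounded_operator_on_UNIV)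
  have eigenvector: "\<exists>f\<in>S - {0}. A f = \<mu> *\<^sub>C f"
    using assms(4) by (simp add: point_spectrum_on_def)
  then obtain f where f: "f \<in> S - {0}"
    by blast
  have "0 \<le> m * ns f"
    using norm_le_mixed_norm[OF diff f] unfolding m_def by (rule order_trans[OF norm_ge_zero])
  then have "0 \<le> m"
    using ns_pos[OF f] by (simp add: zero_le_mult_iff)
  have "norm g \<le> M * m * ns g" if g: "g \<in> S - {0}" "A g = \<mu> *\<^sub>C g" for g
  proof -
    have "norm g \<le> M * norm (A g - A' g)"
      using norm_le_operator_norm_inverse_times_image[OF inv, of g] g(2)
      by (simp add: M_def R_def)
    also have "\<dots> \<le> M * (m * ns g)"
      using norm_le_mixed_norm[OF diff g(1)] \<open>0 \<le> M\<close>
      unfolding m_def by (intro mult_left_mono)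
    finally show ?thesis
      by (simp add: mult.assoc)
  qed
  then have "1 \<le> M * m * eigen_gamma S ns A \<mu>"
    using eigenvector \<open>0 \<le> M\<close> \<open>0 \<le> m\<close> by (intro one_le_mult_eigen_gamma) auto
  also have "\<dots> = M * (eigen_gamma S ns A \<mu> * m)"
    by (simp add: mult_ac)
  also have "\<dots> \<le> M * \<delta>"
    using assms(6) \<open>0 \<le> M\<close> unfolding m_def by (intro mult_left_mono)
  finally have "inverse \<delta> \<le> M"
    using \<open>\<delta> > 0\<close> by (simp add: field_simps)
  then show ?thesis
    using inv by (simp add: pseudospectrum_on_def M_def R_def)
qed

end
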